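(* Let $\mathcal{X}$ be a finite state space, $\pi$ a probability mass function on $\mathcal{X}$ with full support, $P \in \mathcal{S}(\pi)$ and $Q \in \mathcal{I}(\pi) \cap \mathcal{L}$. Let $\Pi$ be the matrix each of whose rows equals $\pi$, and $\overline{P}(Q):=\frac12(P+QP^*Q)$. Then: (1) $D^{\pi}_{KL}(P \| \Pi) = D^{\pi}_{KL}(P Q \| \Pi) = D^{\pi}_{KL}(Q P \| \Pi) = D^{\pi}_{KL}(Q P Q\| \Pi)$. (2) $c_{KL}(P) = c_{KL}(PQ) = c_{KL}(QP) = c_{KL}(QPQ)$. (3) $\mathrm{Tr}(P) = \mathrm{Tr}(QP^*Q) = \mathrm{Tr}(\overline{P}(Q))$.
   Context: $\mathcal{L}$ is the set of transition (row-stochastic) matrices on $\mathcal{X}$; $\mathcal{S}(\pi)\subseteq\mathcal{L}$ is the set of those with $\pi P=\pi$. For a matrix $M$, $M^*(x,y)=\frac{\pi(y)}{\pi(x)}M(y,x)$. $\mathcal{I}(\pi)$ is the set of real matrices $Q$ with $Q^2=I$ and $Q^*=Q$. For $M,N\in\mathcal{L}$, $D^\pi_{KL}(M\|N):=\sum_x\pi(x)\sum_y M(x,y)\ln\frac{M(x,y)}{N(x,y)}\in[0,\infty]$, with $0\ln(0/0)=0$, $0\cdot\infty=0$ and $a\ln(a/0)=+\infty$ for $a>0$. The KL-divergence Dobrushin coefficient of $P\in\mathcal{S}(\pi)$ is $c_{KL}(P):=\sup \frac{D^\pi_{KL}(MP\|NP)}{D^\pi_{KL}(M\|N)}\in[0,1]$,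 the supremum being over $M,N\in\mathcal{S}(\pi)$ with $M\ne N$ and $D^\pi_{KL}(M\|N)<\infty$ (taken to be $0$ if there are no such pairs). *)

theory Defs
  imports "HOL-Analysis.Analysis" "HOL-Library.Extended_Real"
begin

(* The state space is a type 'x of class finite; a matrix on it is an element of real^'x^'x,
   with M $ x $ y the entry in row x, column y. *)

definition full_support_pmf :: "real^'x::finite \<Rightarrow> bool" where
  "full_support_pmf \<pi> \<longleftrightarrow> (\<forall>x. 0 < \<pi> $ x) \<and> (\<Sum>x\<in>UNIV. \<pi> $ x) = 1"

definition transition_matrices :: "(real^'x::finite^'x) set" where
  "transition_matrices = {M. (\<forall>x y. 0 \<le> M $ x $ y) \<and> (\<forall>x. (\<Sum>y\<in>UNIV. M $ x $ y) = 1)}"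

definition stationary_matrices :: "real^'x::finite \<Rightarrow> (real^'x^'x) set" where
  "stationary_matrices \<pi> = {M \<in> transition_matrices. \<pi> v* M = \<pi>}"

definition adjoint_matrix :: "real^'x::finite \<Rightarrow> real^'x^'x \<Rightarrow> real^'x^'x" where
  "adjoint_matrix \<pi> M = (\<chi> x y. \<pi> $ y / \<pi> $ x * M $ y $ x)"

definition isometric_involutions :: "real^'x::finite \<Rightarrow> (real^'x^'x) set" where
  "isometric_involutions \<pi> = {Q. Q ** Q = mat 1 \<and> adjoint_matrix \<pi> Q = Q}"

definition rank_one_matrix :: "real^'x::finite \<Rightarrow> real^'x^'x" where
  "rank_one_matrix \<pi> = (\<chi> x. \<pi>)"

definition P_bar :: "real^'x::finite \<Rightarrow> real^'x^'x \<Rightarrow> real^'x^'x \<Rightarrow> real^'x^'x" where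
  "P_bar \<pi> P Q = (1/2) *\<^sub>R (P + Q ** adjoint_matrix \<pi> P ** Q)"

(* a ln(a/b), with the conventions 0 ln(0/b) = 0 (also for b = 0) and
   a ln(a/0) = +infinity for a > 0. *)
definition kl_term :: "real \<Rightarrow> real \<Rightarrow> ereal" where
  "kl_term a b = (if a = 0 then 0 else if b = 0 then \<infinity> else ereal (a * ln (a / b)))"

(* Individual terms may be negative, hence ereal rather than ennreal; on transition matrices
   no term is -infinity, so every sum is an unambiguous extended-real sum. *)
definition D_KL :: "real^'x::finite \<Rightarrow> real^'x^'x \<Rightarrow> real^'x^'x \<Rightarrow> ereal" where
  "D_KL \<pi> M N = (\<Sum>x\<in>UNIV. ereal (\<pi> $ x) * (\<Sum>y\<in>UNIV. kl_term (M $ x $ y) (N $ x $ y)))"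

definition c_KL_pairs :: "real^'x::finite \<Rightarrow> ((real^'x^'x) \<times> (real^'x^'x)) set" where
  "c_KL_pairs \<pi> = {(M, N). M \<in> stationary_matrices \<pi> \<and> N \<in> stationary_matrices \<pi> \<and>
                           M \<noteq> N \<and> D_KL \<pi> M N < \<infinity>}"

(* The supremum of the empty set in ereal is -infinity, so the case without admissible pairs
   (a one-point state space) is separated out. *)
definition c_KL :: "real^'x::finite \<Rightarrow> real^'x^'x \<Rightarrow> ereal" where
  "c_KL \<pi> P = (if c_KL_pairs \<pi> = {} then 0
               else SUP (M, N)\<in>c_KL_pairs \<pi>. D_KL \<pi> (M ** P) (N ** P) / D_KL \<pi> M N)"

end

theory Submission
  imports Defs
begin

text \<open>A nonnegative \<open>Q\<close> with row sums \<open>1\<close> and \<open>Q\<^sup>2 = I\<close> is the matrix of an involutive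
  permutation \<open>\<sigma>\<close> of the state space, and self-adjointness says that \<open>\<sigma>\<close> preserves \<open>\<pi>\<close>. Hence
  multiplication by \<open>Q\<close> on either side only permutes the terms of the divergence and fixes the
  rank-one matrix, and \<open>M \<mapsto> MQ\<close> permutes the pairs over which the Dobrushin coefficient is a
  supremum. The trace identities follow from cyclicity.\<close>

definition swap_matrix :: "('x \<Rightarrow> 'x) \<Rightarrow> real^'x::finite^'x" where
  "swap_matrix \<sigma> = (\<chi> x y. if y = \<sigma> x then 1 else 0)"

lemma swap_matrix_mult_left: "(swap_matrix \<sigma> ** M) $ x $ y = M $ \<sigma> x $ y"
  by (simp add: swap_matrix_def matrix_matrix_mult_def if_distrib[of "\<lambda>a. a * _"] cong: if_cong)

text \<open>Column \<open>y\<close> of the swap matrix has its ones at the preimages of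
  \<open>y\<close>, and for an involution the only preimage is \<open>\<sigma> y\<close>.\<close>

lemma swap_matrix_mult_right:
  assumes "\<And>x. \<sigma> (\<sigma> x) = x"
  shows "(M ** swap_matrix \<sigma>) $ x $ y = M $ x $ \<sigma> y"
proof -
  have "y = \<sigma> z \<longleftrightarrow> z = \<sigma> y" for z
    using assms by metis
  then show ?thesis
    by (simp add: swap_matrix_def matrix_matrix_mult_def if_distrib[of "\<lambda>a. _ * a"] cong: if_cong)
qed

text \<open>An off-diagonal entry of \<open>Q ** Q\<close> is a vanishing sum of nonnegative terms,
  so every term vanishes. Hence a nonzero entry at \<open>(x, z)\<close> confines row
  \<open>z\<close> to column \<open>x\<close>, and the row sum makes that entry
  \<open>1\<close>.\<close>

lemma nonneg_involution_eq_swap_matrix: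
  assumes Q: "Q \<in> transition_matrices" and QQ: "Q ** Q = mat 1"
  obtains \<sigma> where "\<And>x. \<sigma> (\<sigma> x) = x" and "Q = swap_matrix \<sigma>"
proof -
  have nonneg: "0 \<le> Q $ x $ y" and row: "(\<Sum>y\<in>UNIV. Q $ x $ y) = 1" for x y
    using Q by (auto simp: transition_matrices_def)
  have zero: "Q $ z $ y = 0" if "Q $ x $ z \<noteq> 0" "y \<noteq> x" for x y z
  proof -
    have "(Q ** Q) $ x $ y = 0"
      using that by (simp add: QQ mat_def)
    then have "(\<Sum>z\<in>UNIV. Q $ x $ z * Q $ z $ y) = 0"
      by (simp add: matrix_matrix_mult_def)
    then have "Q $ x $ z * Q $ z $ y = 0"
      by (subst (asm) sum_nonneg_eq_0_iff) (auto simp: nonneg)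
    then show ?thesis using that by simp
  qed
  have one: "Q $ z $ x = 1" if "Q $ x $ z \<noteq> 0" for x z
  proof -
    have "(\<Sum>y\<in>UNIV. Q $ z $ y) = (\<Sum>y\<in>{x}. Q $ z $ y)"
      using zero[OF that] by (intro sum.mono_neutral_right) auto
    then show ?thesis using row[of z] by simp
  qed
  have "\<exists>z. Q $ x $ z \<noteq> 0" for x
    using row[of x] by (metis sum.neutral zero_neq_one)
  then obtain \<sigma> where \<sigma>: "\<And>x. Q $ x $ \<sigma> x \<noteq> 0"
    by metis
  have from_image: "Q $ \<sigma> x $ x = 1" for x
    using one \<sigma> by blast
  \<comment> \<open>The same argument runs back along the transposed entry, which is now known to be
    nonzero.\<close>
  have to_image: "Q $ x $ \<sigma> x = 1" for x
    using one from_image by (metis zero_neq_one)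
  have off: "Q $ x $ y = 0" if "y \<noteq> \<sigma> x" for x y
    using zero[of "\<sigma> x" x y] from_image[of x] that by simp
  \<comment> \<open>Row \<open>\<sigma> x\<close> vanishes outside column
    \<open>\<sigma> (\<sigma> x)\<close>, yet its entry in column \<open>x\<close> is
    \<open>1\<close>.\<close>
  have "\<sigma> (\<sigma> x) = x" for x
    using off[where x="\<sigma> x" and y=x] from_image[of x] by (metis zero_neq_one)
  moreover have "Q = swap_matrix \<sigma>"
    using to_image off by (auto simp: swap_matrix_def vec_eq_iff)
  ultimately show ?thesis ..
qed

lemma swap_matrix_preserves_weight:
  assumes pos: "\<And>x. 0 < \<pi> $ x" and inv: "\<And>x. \<sigma> (\<sigma> x) = x"
    and adj: "adjoint_matrix \<pi> (swap_matrix \<sigma>) = swap_matrix \<sigma>"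
  shows "\<pi> $ \<sigma> x = \<pi> $ x"
proof -
  have "adjoint_matrix \<pi> (swap_matrix \<sigma>) $ x $ \<sigma> x = 1"
    unfolding adj by (simp add: swap_matrix_def)
  then have "\<pi> $ \<sigma> x / \<pi> $ x = 1"
    by (simp add: adjoint_matrix_def swap_matrix_def inv)
  then show ?thesis
    using pos[of x] by (simp add: field_simps)
qed

lemma D_KL_swap_right:
  assumes inv: "\<And>x. \<sigma> (\<sigma> x) = x"
  shows "D_KL \<pi> (M ** swap_matrix \<sigma>) (N ** swap_matrix \<sigma>) = D_KL \<pi> M N"
proof -
  have "(\<Sum>y\<in>UNIV. kl_term (M $ x $ \<sigma> y) (N $ x $ \<sigma> y))
      = (\<Sum>y\<in>UNIV. kl_term (M $ x $ y) (N $ x $ y))" for x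
    by (rule sum.reindex_bij_witness[of _ \<sigma> \<sigma>]) (auto simp: inv)
  then show ?thesis
    by (simp add: D_KL_def swap_matrix_mult_right[OF inv])
qed

text \<open>Rows are permuted here, and each row carries its weight under \<open>\<pi>\<close>, so
  the reindexing relies on \<open>\<sigma>\<close> preserving these weights.\<close>

lemma D_KL_swap_left:
  assumes inv: "\<And>x. \<sigma> (\<sigma> x) = x" and weight: "\<And>x. \<pi> $ \<sigma> x = \<pi> $ x"
  shows "D_KL \<pi> (swap_matrix \<sigma> ** M) (swap_matrix \<sigma> ** N) = D_KL \<pi> M N"
  unfolding D_KL_def swap_matrix_mult_left
  by (rule sum.reindex_bij_witness[of _ \<sigma> \<sigma>]) (auto simp: inv weight)

lemma swap_matrix_mult_rank_one: "swap_matrix \<sigma> ** rank_one_matrix \<pi> = rank_one_matrix \<pi>"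
  by (simp add: vec_eq_iff swap_matrix_mult_left rank_one_matrix_def)

lemma rank_one_mult_swap_matrix:
  assumes "\<And>x. \<sigma> (\<sigma> x) = x" and "\<And>x. \<pi> $ \<sigma> x = \<pi> $ x"
  shows "rank_one_matrix \<pi> ** swap_matrix \<sigma> = rank_one_matrix \<pi>"
  by (simp add: vec_eq_iff swap_matrix_mult_right rank_one_matrix_def assms)

text \<open>This keeps the admissible pairs of the Dobrushin coefficient closed under right
  multiplication. The product sends \<open>\<pi>\<close> to \<open>\<pi>\<close> composed with
  \<open>\<sigma>\<close>, which is \<open>\<pi>\<close> again.\<close>

lemma stationary_mult_swap_matrix:
  assumes inv: "\<And>x. \<sigma> (\<sigma> x) = x" and weight: "\<And>x. \<pi> $ \<sigma> x = \<pi> $ x"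
    and M: "M \<in> stationary_matrices \<pi>"
  shows "M ** swap_matrix \<sigma> \<in> stationary_matrices \<pi>"
proof -
  have "(\<Sum>y\<in>UNIV. M $ x $ \<sigma> y) = (\<Sum>y\<in>UNIV. M $ x $ y)" for x
    by (rule sum.reindex_bij_witness[of _ \<sigma> \<sigma>]) (auto simp: inv)
  then have "M ** swap_matrix \<sigma> \<in> transition_matrices"
    using M by (auto simp: stationary_matrices_def transition_matrices_def
        swap_matrix_mult_right[OF inv])
  moreover have "(\<pi> v* (M ** swap_matrix \<sigma>)) $ y = \<pi> $ y" for y
  proof -
    have "(\<pi> v* (M ** swap_matrix \<sigma>)) $ y = (\<pi> v* M) $ \<sigma> y"
      by (simp add: vector_matrix_mult_def swap_matrix_mult_right[OF inv])
    then show ?thesis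
      using M weight by (simp add: stationary_matrices_def)
  qed
  ultimately show ?thesis
    by (simp add: stationary_matrices_def vec_eq_iff)
qed

text \<open>By associativity the extra factor acts last on both arguments of the numerator, so each
  ratio is unchanged.\<close>

lemma c_KL_swap_right:
  assumes "\<And>x. \<sigma> (\<sigma> x) = x"
  shows "c_KL \<pi> (P ** swap_matrix \<sigma>) = c_KL \<pi> P"
  by (simp add: c_KL_def matrix_mul_assoc D_KL_swap_right[OF assms])

lemma c_KL_swap_left:
  assumes inv: "\<And>x. \<sigma> (\<sigma> x) = x" and weight: "\<And>x. \<pi> $ \<sigma> x = \<pi> $ x"
  shows "c_KL \<pi> (swap_matrix \<sigma> ** P) = c_KL \<pi> P"
proof -
  let ?S = "swap_matrix \<sigma>"
  have S: "M ** ?S ** ?S = M" for M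
    by (simp add: vec_eq_iff swap_matrix_mult_right[OF inv] inv)
  have pairs: "(M ** ?S, N ** ?S) \<in> c_KL_pairs \<pi>" if "(M, N) \<in> c_KL_pairs \<pi>" for M N
  proof -
    \<comment> \<open>Multiplying by \<open>?S\<close> once more recovers \<open>M\<close> and
      \<open>N\<close>, so distinct matrices stay distinct.\<close>
    have "M ** ?S \<noteq> N ** ?S"
      using that S[of M] S[of N] by (auto simp: c_KL_pairs_def)
    then show ?thesis
      using that
      by (auto simp: c_KL_pairs_def D_KL_swap_right[OF inv] stationary_mult_swap_matrix[OF inv weight])
  qed
  let ?f = "\<lambda>P (M, N). D_KL \<pi> (M ** P) (N ** P) / D_KL \<pi> M N"
  \<comment> \<open>Stated for every \<open>R\<close> so that \<open>R = P\<close> and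
    \<open>R = ?S ** P\<close> give the two opposite inequalities.\<close>
  have le: "Sup (?f (?S ** R) ` c_KL_pairs \<pi>) \<le> Sup (?f R ` c_KL_pairs \<pi>)" for R
  proof (rule SUP_mono, clarify)
    fix M N assume MN: "(M, N) \<in> c_KL_pairs \<pi>"
    have "?f (?S ** R) (M, N) = ?f R (M ** ?S, N ** ?S)"
      by (simp add: matrix_mul_assoc D_KL_swap_right[OF inv])
    then show "\<exists>p\<in>c_KL_pairs \<pi>. D_KL \<pi> (M ** (?S ** R)) (N ** (?S ** R)) / D_KL \<pi> M N \<le> ?f R p"
      using pairs[OF MN] by (intro bexI[of _ "(M ** ?S, N ** ?S)"]) auto
  qed
  have SSP: "?S ** (?S ** P) = P"
    by (simp add: vec_eq_iff swap_matrix_mult_left inv)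
  have "Sup (?f (?S ** P) ` c_KL_pairs \<pi>) = Sup (?f P ` c_KL_pairs \<pi>)"
    using le[of P] le[of "?S ** P"] by (simp only: SSP antisym)
  then show ?thesis
    by (simp only: c_KL_def)
qed

lemma trace_adjoint_matrix:
  assumes "\<And>x. \<pi> $ x \<noteq> 0"
  shows "trace (adjoint_matrix \<pi> M) = trace M"
  by (simp add: trace_def adjoint_matrix_def assms)

lemma trace_conjugate_involution:
  fixes M Q :: "real^'n^'n"
  assumes "Q ** Q = mat 1"
  shows "trace (Q ** M ** Q) = trace M"
  by (metis assms matrix_mul_assoc matrix_mul_lid trace_mul_sym)

theorem proposition3p2:
  fixes \<pi> :: "real^'x::finite" and P Q :: "real^'x^'x"
  assumes "full_support_pmf \<pi>"
    and "P \<in> stationary_matrices \<pi>"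
    and "Q \<in> isometric_involutions \<pi> \<inter> transition_matrices"
  shows "(D_KL \<pi> P (rank_one_matrix \<pi>) = D_KL \<pi> (P ** Q) (rank_one_matrix \<pi>) \<and>
          D_KL \<pi> (P ** Q) (rank_one_matrix \<pi>) = D_KL \<pi> (Q ** P) (rank_one_matrix \<pi>) \<and>
          D_KL \<pi> (Q ** P) (rank_one_matrix \<pi>) = D_KL \<pi> (Q ** P ** Q) (rank_one_matrix \<pi>)) \<and>
         (c_KL \<pi> P = c_KL \<pi> (P ** Q) \<and>
          c_KL \<pi> (P ** Q) = c_KL \<pi> (Q ** P) \<and>
          c_KL \<pi> (Q ** P) = c_KL \<pi> (Q ** P ** Q)) \<and>
         (trace P = trace (Q ** adjoint_matrix \<pi> P ** Q) \<and>
          trace (Q ** adjoint_matrix \<pi> P ** Q) = trace (P_bar \<pi> P Q))"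
proof -
  have pos: "\<And>x. 0 < \<pi> $ x"
    using assms(1) by (simp add: full_support_pmf_def)
  have QQ: "Q ** Q = mat 1" and adj: "adjoint_matrix \<pi> Q = Q" and Q: "Q \<in> transition_matrices"
    using assms(3) by (auto simp: isometric_involutions_def)
  obtain \<sigma> where inv: "\<And>x. \<sigma> (\<sigma> x) = x" and Q_eq: "Q = swap_matrix \<sigma>"
    using nonneg_involution_eq_swap_matrix[OF Q QQ] by blast
  have weight: "\<pi> $ \<sigma> x = \<pi> $ x" for x
    using swap_matrix_preserves_weight[OF pos inv] adj Q_eq by blast
  let ?R = "rank_one_matrix \<pi>"
  \<comment> \<open>The invariance lemma multiplies both arguments by \<open>Q\<close>; the second
    one absorbs it.\<close>
  have right: "D_KL \<pi> (M ** Q) ?R = D_KL \<pi> M ?R" for M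
    using D_KL_swap_right[OF inv, of \<pi> M ?R]
    by (simp add: Q_eq rank_one_mult_swap_matrix[OF inv weight])
  have left: "D_KL \<pi> (Q ** M) ?R = D_KL \<pi> M ?R" for M
    using D_KL_swap_left[OF inv weight, of M ?R]
    by (simp add: Q_eq swap_matrix_mult_rank_one)
  have c_right: "c_KL \<pi> (M ** Q) = c_KL \<pi> M" and c_left: "c_KL \<pi> (Q ** M) = c_KL \<pi> M" for M
    using c_KL_swap_right[OF inv] c_KL_swap_left[OF inv weight] by (simp_all add: Q_eq)
  have tr: "trace (Q ** adjoint_matrix \<pi> P ** Q) = trace P"
    using trace_conjugate_involution[OF QQ] trace_adjoint_matrix pos by (metis less_irrefl)
  \<comment> \<open>By linearity this is the mean of two traces that \<open>tr\<close> shows to be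
    equal.\<close>
  have "trace (P_bar \<pi> P Q) = (trace P + trace (Q ** adjoint_matrix \<pi> P ** Q)) / 2"
    unfolding P_bar_def by (simp add: trace_def sum.distrib flip: sum_divide_distrib)
  then show ?thesis
    by (simp add: right left c_right c_left tr)
qed

end
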